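(* The spaces $\mathcal{U}_3(\mathbb{F}_2)$ and $\mathcal{V}_3(\mathbb{F}_2)$ are primitive subspaces of $\mathrm{M}_3(\mathbb{F}_2)$ with upper rank $2$. Moreover, every non-zero matrix of one of those spaces has rank $2$.
   Context: $\mathrm{M}_{n,p}(\mathbb{K})$ is the space of $n\times p$ matrices over a field $\mathbb{K}$, and $\mathrm{M}_n(\mathbb{K})=\mathrm{M}_{n,n}(\mathbb{K})$. The upper rank $\operatorname{urk}(\mathcal{V})$ of a linear subspace $\mathcal{V}$ of $\mathrm{M}_{n,p}(\mathbb{K})$ is the maximal rank of a matrix in $\mathcal{V}$. Two linear subspaces $\mathcal{V}_1,\mathcal{V}_2$ of $\mathrm{M}_{n,p}(\mathbb{K})$ are equivalent when $\mathcal{V}_2=P\mathcal{V}_1Q$ for some $P\in\mathrm{GL}_n(\mathbb{K})$, $Q\in\mathrm{GL}_p(\mathbb{K})$. A linear subspace $\mathcal{V}$ of $\mathrm{M}_{n,p}(\mathbb{K})$ with upper rank $r$ is called primitive when: (i) no non-zero vector of $\mathbb{K}^p$ belongs to the kernel of every matrix of $\mathcal{V}$; (ii) the span of the ranges of all the matrices of $\mathcal{V}$ is $\mathbb{K}^n$; (iii) $\mathcal{V}$ is not equivalent to a space $\mathcal{T}$ of matrices of the form $M=\begin{bmatrix} H(M) & [?]_{n\times 1}\end{bmatrix}$ (so $H(M)\in\mathrm{M}_{n,p-1}(\mathbb{K})$) where $\operatorname{urk}H(\mathcal{T})\leq r-1$; (iv) $\mathcal{V}$ is not equivalent to a space $\mathcal{T}$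 of matrices of the form $M=\begin{bmatrix} H(M)\\ [?]_{1\times p}\end{bmatrix}$ (so $H(M)\in\mathrm{M}_{n-1,p}(\mathbb{K})$) where $\operatorname{urk}H(\mathcal{T})\leq r-1$. The two spaces are $$\mathcal{U}_3(\mathbb{F}_2)=\left\{\begin{bmatrix}0&a&a+c\\ a&0&b\\ a+b&c&0\end{bmatrix} \mid (a,b,c)\in\mathbb{F}_2^3\right\},\qquad \mathcal{V}_3(\mathbb{F}_2)=\left\{\begin{bmatrix}0&a&c+d\\ c&0&b\\ a+b&d&0\end{bmatrix} \mid (a,b,c,d)\in\mathbb{F}_2^4\right\}.$$ *)

theory Defs
  imports "Jordan_Normal_Form.DL_Rank" "Jordan_Normal_Form.Matrix_Kernel" "HOL-Library.Z2"
begin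

text \<open>Matrices with \<open>n\<close> rows and \<open>p\<close> columns over a field are the elements of
  \<^term>\<open>carrier_mat n p\<close>; the two-element field is the type \<^typ>\<open>bit\<close>.\<close>

definition mat_subspace :: "nat \<Rightarrow> nat \<Rightarrow> 'a::field mat set \<Rightarrow> bool" where
  "mat_subspace n p \<V> \<longleftrightarrow> VectorSpace.subspace class_ring \<V> (module_mat TYPE('a) n p)"

text \<open>The maximum is taken over a finite set of ranks, all bounded by the number \<open>n\<close> of rows, even
  when the space itself is infinite. The parameter \<open>n\<close> is needed by \<^const>\<open>vec_space.rank\<close>, which
  is the dimension of the span of the columns inside \<open>K\<^sup>n\<close>.\<close>

definition upper_rank :: "nat \<Rightarrow> 'a::field mat set \<Rightarrow> nat" where
  "upper_rank n \<V> = Max (vec_space.rank n ` \<V>)"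

definition mat_equivalent :: "nat \<Rightarrow> nat \<Rightarrow> 'a::field mat set \<Rightarrow> 'a mat set \<Rightarrow> bool" where
  "mat_equivalent n p \<V> \<W> \<longleftrightarrow>
     (\<exists>P Q. P \<in> carrier_mat n n \<and> invertible_mat P \<and> Q \<in> carrier_mat p p \<and> invertible_mat Q \<and>
        \<W> = (\<lambda>M. P * M * Q) ` \<V>)"

text \<open>The block \<open>H(M)\<close> in \<open>M = [H(M) | ?]\<close>, respectively in the version with rows, is determined
  by \<open>M\<close>: it consists of all columns (rows) of \<open>M\<close> but the last one.\<close>

definition drop_last_col :: "'a mat \<Rightarrow> 'a mat" where
  "drop_last_col M = mat (dim_row M) (dim_col M - 1) (\<lambda>(i, j). M $$ (i, j))"

definition drop_last_row :: "'a mat \<Rightarrow> 'a mat" where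
  "drop_last_row M = mat (dim_row M - 1) (dim_col M) (\<lambda>(i, j). M $$ (i, j))"

text \<open>The third and fourth conditions have no content when there is no column (row) to split off,
  hence the guards. The bound \<open>urk H(\<T>) \<le> r - 1\<close> is written with \<open><\<close> to avoid truncated
  subtraction for \<open>r = 0\<close>.\<close>

definition primitive_space :: "nat \<Rightarrow> nat \<Rightarrow> 'a::field mat set \<Rightarrow> bool" where
  "primitive_space n p \<V> \<longleftrightarrow>
     mat_subspace n p \<V> \<and>
     \<not> (\<exists>x \<in> carrier_vec p. x \<noteq> 0\<^sub>v p \<and> (\<forall>M \<in> \<V>. x \<in> mat_kernel M)) \<and>
     LinearCombinations.module.span class_ring (module_vec TYPE('a) n)
        (\<Union>M \<in> \<V>. (\<lambda>x. M *\<^sub>v x) ` carrier_vec p) = carrier_vec n \<and>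
     \<not> (1 \<le> p \<and> (\<exists>\<T>. mat_equivalent n p \<V> \<T> \<and>
          upper_rank n (drop_last_col ` \<T>) < upper_rank n \<V>)) \<and>
     \<not> (1 \<le> n \<and> (\<exists>\<T>. mat_equivalent n p \<V> \<T> \<and>
          upper_rank (n - 1) (drop_last_row ` \<T>) < upper_rank n \<V>))"

definition U3 :: "bit mat set" where
  "U3 = {mat_of_rows_list 3
           [[0,     a, a + c],
            [a,     0, b    ],
            [a + b, c, 0    ]] | a b c. True}"

definition V3 :: "bit mat set" where
  "V3 = {mat_of_rows_list 3
           [[0,     a, c + d],
            [c,     0, b    ],
            [a + b, d, 0    ]] | a b c d. True}"

end

theory Submission
  imports Defs
begin

text \<open>Every matrix of \<open>V\<^sub>3\<close> has zero diagonal, and its off-diagonal entries split into two cyclic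
  triples of bits, each with sum zero. Hence the determinant vanishes while a nonzero matrix has an
  invertible two-by-two block, so all nonzero matrices have rank two and a kernel with one nonzero
  vector (\<open>V3_kernel_equations\<close>, \<open>rank_nonzero_V3\<close>). Replacing \<open>(a, b, c, d)\<close> by \<open>(a, b, a, c)\<close> shows
  \<open>U\<^sub>3 \<subseteq> V\<^sub>3\<close>, so the same holds for \<open>U\<^sub>3\<close>, and both upper ranks are two.

  For primitivity, up to equivalence, deleting a column restricts all matrices to a plane \<open>W\<close>, and
  deleting a row composes them with a projection along a line \<open>L\<close>. A matrix of rank two keeps its
  rank under the first operation if its kernel is not in \<open>W\<close>, and under the second if its range does
  not contain \<open>L\<close>. So the upper rank survives every such deletion if the kernels of the rank-two
  matrices span the space and their ranges meet only in zero (\<open>upper_rank_drop_last_col_ge\<close>,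
  \<open>upper_rank_drop_last_row_ge\<close>). The basis matrices of \<open>U\<^sub>3\<close> already have both properties
  (\<open>U3_kernels_span\<close>, \<open>U3_ranges_meet_trivially\<close>), have no common kernel vector, and have ranges that
  span the space; all of this passes to \<open>V\<^sub>3\<close>.\<close>

section \<open>Rank and kernel\<close>

text \<open>Rank-nullity for the linear map \<open>v \<mapsto> A v\<close>, whose image is the column space of \<open>A\<close>. All rank
  estimates below go through kernels, which behave well under equivalence.\<close>
lemma rank_plus_kernel_dim:
  fixes A :: "'a::field mat"
  assumes A: "A \<in> carrier_mat n nc"
  shows "vec_space.rank n A + kernel.dim nc A = nc"
proof -
  interpret W: vec_space "TYPE('a)" n .
  interpret K: kernel n nc A by unfold_locales (rule A)
  have hom: "(\<lambda>v. A *\<^sub>v v) \<in> LinearCombinations.module_hom class_ring K.NC.V W.V"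
    using A by (auto simp: LinearCombinations.module_hom_def module_vec_simps mult_add_distrib_mat_vec mult_mat_vec)
  interpret T: linear_map class_ring K.NC.V W.V "\<lambda>v. A *\<^sub>v v"
    by unfold_locales (rule hom)
  have im: "T.imT = W.span (set (cols A))"
    using W.col_space_eq[OF A] A unfolding T.im_def W.col_space_def
    by (auto simp: module_vec_simps)
  have ker: "T.kerT = mat_kernel A"
    using A unfolding T.ker_def mat_kernel[OF A] by (auto simp: module_vec_simps)
  show ?thesis
    using T.rank_nullity[OF K.NC.fin_dim] unfolding im ker W.rank_def K.NC.dim_is_n .
qed

lemma rank_eq_if_kernel_trivial:
  fixes A :: "'a::field mat"
  assumes A: "A \<in> carrier_mat n nc" and ker: "mat_kernel A \<subseteq> {0\<^sub>v nc}"
  shows "vec_space.rank n A = nc"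
proof -
  interpret K: kernel n nc A by unfold_locales (rule A)
  have "0\<^sub>v nc \<in> mat_kernel A" using A by (auto simp: mat_kernel[OF A])
  hence eq: "mat_kernel A = {0\<^sub>v nc}" using ker by blast
  have "K.dim = 0"
    using K.Ker.span_is_subset2[of "{0\<^sub>v nc}"] K.Ker.in_own_span[of "{0\<^sub>v nc}"] eq
    by (intro K.Ker.dim0I) auto
  thus ?thesis using rank_plus_kernel_dim[OF A] by simp
qed

text \<open>A kernel inside a line has dimension at most one. The vector \<open>z\<close> need not be in the kernel, so
  a nonzero kernel vector, when there is one, serves as the generator.\<close>
lemma rank_ge_if_kernel_in_line:
  fixes A :: "'a::field mat"
  assumes A: "A \<in> carrier_mat n nc" and ker: "mat_kernel A \<subseteq> range (\<lambda>c. c \<cdot>\<^sub>v z)"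
  shows "nc - 1 \<le> vec_space.rank n A"
proof (cases "mat_kernel A \<subseteq> {0\<^sub>v nc}")
  case True
  thus ?thesis using rank_eq_if_kernel_trivial[OF A] by simp
next
  case False
  interpret K: kernel n nc A by unfold_locales (rule A)
  from False obtain k where k: "k \<in> mat_kernel A" "k \<noteq> 0\<^sub>v nc" by blast
  have kc: "k \<in> carrier_vec nc" using mat_kernelD[OF A k(1)] by simp
  obtain c where c: "k = c \<cdot>\<^sub>v z" using k ker by blast
  have zc: "z \<in> carrier_vec nc" using kc c by auto
  have c0: "c \<noteq> 0" using k(2) c zc by auto
  have "v \<in> K.span {k}" if v: "v \<in> mat_kernel A" for v
  proof -
    obtain d where d: "v = d \<cdot>\<^sub>v z" using v ker by blast
    have "v = (d / c) \<cdot>\<^sub>v k" using c c0 d zc by (auto simp: smult_smult_assoc)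
    also have "\<dots> = K.lincomb (\<lambda>_. d / c) {k}"
      using k(1) kc by (subst K.Ker.lincomb_def) (auto simp: K.Ker.M.finsum_insert)
    finally show ?thesis unfolding K.Ker.span_def by blast
  qed
  hence "mat_kernel A \<subseteq> K.span {k}" by blast
  moreover have "K.span {k} \<subseteq> mat_kernel A" using K.Ker.span_is_subset2 k(1) by auto
  ultimately have "K.dim \<le> 1"
    by (intro K.Ker.dim_le1I[of k]) (use k(1) in auto)
  thus ?thesis using rank_plus_kernel_dim[OF A] by simp
qed

text \<open>For a square matrix this follows from the vanishing of the determinant.\<close>
lemma rank_less_if_kernel_nontrivial:
  fixes A :: "'a::field mat"
  assumes A: "A \<in> carrier_mat n n" and z: "z \<in> mat_kernel A" "z \<noteq> 0\<^sub>v n"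
  shows "vec_space.rank n A < n"
proof -
  have "det A = 0"
    using det_0_iff_vec_prod_zero_field[OF A] mat_kernelD[OF A z(1)] z(2) by blast
  thus ?thesis by (rule vec_space.det_zero_low_rank[OF A])
qed

text \<open>The number of columns bounds all ranks, so the maximum defining the upper rank is over a finite
  set even if \<open>S\<close> is infinite.\<close>
lemma rank_le_upper_rank:
  fixes S :: "'a::field mat set"
  assumes S: "S \<subseteq> carrier_mat n nc" and A: "A \<in> S"
  shows "vec_space.rank n A \<le> upper_rank n S"
proof -
  have "vec_space.rank n ` S \<subseteq> {..nc}"
    using S vec_space.rank_le_nc by blast
  hence "finite (vec_space.rank n ` S)" by (rule finite_subset) simp
  thus ?thesis unfolding upper_rank_def using A by (intro Max_ge) auto
qed

section \<open>Deleting a column or a row from an equivalent space\<close>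

lemma invertible_matE:
  fixes Q :: "'a::field mat"
  assumes "invertible_mat Q" and Q: "Q \<in> carrier_mat n n"
  obtains Q' where "Q' \<in> carrier_mat n n" "Q * Q' = 1\<^sub>m n" "Q' * Q = 1\<^sub>m n"
proof -
  from assms obtain Q' where i: "Q * Q' = 1\<^sub>m n" "Q' * Q = 1\<^sub>m (dim_row Q')"
    unfolding invertible_mat_def inverts_mat_def by auto
  have "dim_col Q' = n" using arg_cong[OF i(1), of dim_col] by simp
  moreover have "dim_row Q' = n" using arg_cong[OF i(2), of dim_col] Q by simp
  ultimately show ?thesis using that i by auto
qed

text \<open>Deleting the last column restricts the map to the vectors whose last coordinate is zero.\<close>
lemma drop_last_col_mult_vec:
  fixes N :: "'a::field mat"
  assumes "N \<in> carrier_mat n (Suc q)" "y \<in> carrier_vec q"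
  shows "drop_last_col N *\<^sub>v y = N *\<^sub>v vec (Suc q) (\<lambda>i. if i < q then y $ i else 0)"
  using assms by (intro eq_vecI) (auto simp: drop_last_col_def scalar_prod_def)

text \<open>Deleting the last row forgets the last coordinate of the image.\<close>
lemma drop_last_row_mult_vec:
  fixes N :: "'a::field mat"
  assumes "N \<in> carrier_mat (Suc q) p" "y \<in> carrier_vec p" "i < q"
  shows "(drop_last_row N *\<^sub>v y) $ i = (N *\<^sub>v y) $ i"
  using assms by (auto simp: drop_last_row_def scalar_prod_def)

text \<open>Deleting the last column of \<open>P M Q\<close> restricts \<open>M\<close>, up to isomorphisms, to the hyperplane
  spanned by the first columns of \<open>Q\<close>. The assumption says that no hyperplane \<open>l = 0\<close> contains all the
  lines \<open>K z\<close> that bound the kernels; a line outside the hyperplane comes from an \<open>M\<close> that is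
  injective on it, so that the rank is the dimension \<open>p - 1\<close> of the hyperplane.\<close>
lemma upper_rank_drop_last_col_ge:
  fixes V :: "'a::field mat set"
  assumes V: "V \<subseteq> carrier_mat n p"
    and ker: "\<And>l. l \<in> carrier_vec p \<Longrightarrow> l \<noteq> 0\<^sub>v p \<Longrightarrow>
      \<exists>M\<in>V. \<exists>z\<in>carrier_vec p. mat_kernel M \<subseteq> range (\<lambda>c. c \<cdot>\<^sub>v z) \<and> l \<bullet> z \<noteq> 0"
    and T: "mat_equivalent n p V T"
  shows "p - 1 \<le> upper_rank n (drop_last_col ` T)"
proof (cases p)
  case 0
  thus ?thesis by simp
next
  case q: (Suc q)
  from T obtain P Q where P: "P \<in> carrier_mat n n" "invertible_mat P"
    and Q: "Q \<in> carrier_mat p p" "invertible_mat Q" and TV: "T = (\<lambda>M. P * M * Q) ` V"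
    unfolding mat_equivalent_def by blast
  obtain P' where P': "P' \<in> carrier_mat n n" "P' * P = 1\<^sub>m n"
    using invertible_matE[OF P(2,1)] by blast
  obtain Q' where Q': "Q' \<in> carrier_mat p p" "Q * Q' = 1\<^sub>m p" "Q' * Q = 1\<^sub>m p"
    using invertible_matE[OF Q(2,1)] by blast
  \<comment> \<open>The functional \<open>l\<close> is the last coordinate with respect to the basis of columns of \<open>Q\<close>; it
    vanishes exactly on the span of the first \<open>q\<close> columns.\<close>
  define l where "l = row Q' q"
  have l: "l \<in> carrier_vec p" using Q'(1) unfolding l_def by auto
  have "l \<bullet> col Q q = 1"
    using arg_cong[OF Q'(3), of "\<lambda>A. A $$ (q, q)"] Q Q'(1) q unfolding l_def by simp
  hence "l \<noteq> 0\<^sub>v p" using col_carrier_vec[OF _ Q(1), of q] q by auto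
  from ker[OF l this] obtain M z where M: "M \<in> V" and z: "z \<in> carrier_vec p"
    and Mz: "mat_kernel M \<subseteq> range (\<lambda>c. c \<cdot>\<^sub>v z)" and lz: "l \<bullet> z \<noteq> 0" by blast
  have Mc: "M \<in> carrier_mat n p" using M V by blast
  define N where "N = P * M * Q"
  have N: "N \<in> carrier_mat n p" using P Mc Q unfolding N_def by simp
  have D: "drop_last_col N \<in> carrier_mat n q" using N q by (simp add: drop_last_col_def)
  have "mat_kernel (drop_last_col N) \<subseteq> {0\<^sub>v q}"
  proof
    fix y assume "y \<in> mat_kernel (drop_last_col N)"
    hence y: "y \<in> carrier_vec q" "drop_last_col N *\<^sub>v y = 0\<^sub>v n" using mat_kernelD[OF D] by auto
    define x where "x = vec p (\<lambda>i. if i < q then y $ i else 0)"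
    have x: "x \<in> carrier_vec p" unfolding x_def by simp
    have Qx: "Q *\<^sub>v x \<in> carrier_vec p" using Q x by simp
    have MQx: "M *\<^sub>v (Q *\<^sub>v x) \<in> carrier_vec n" using Mc Qx by simp
    have Nx: "N *\<^sub>v x = 0\<^sub>v n"
      using drop_last_col_mult_vec[OF N[unfolded q] y(1)] y(2) unfolding x_def q by simp
    have "N *\<^sub>v x = P *\<^sub>v (M *\<^sub>v (Q *\<^sub>v x))"
      unfolding N_def using P(1) Mc Q(1) Qx x
        assoc_mult_mat_vec[of "P * M" n p Q p x] assoc_mult_mat_vec[of P n n M p "Q *\<^sub>v x"] by simp
    hence "P' *\<^sub>v (P *\<^sub>v (M *\<^sub>v (Q *\<^sub>v x))) = P' *\<^sub>v 0\<^sub>v n" using Nx by simp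
    also have "\<dots> = 0\<^sub>v n" using P'(1) by auto
    finally have "P' *\<^sub>v (P *\<^sub>v (M *\<^sub>v (Q *\<^sub>v x))) = 0\<^sub>v n" .
    hence "M *\<^sub>v (Q *\<^sub>v x) = 0\<^sub>v n"
      using assoc_mult_mat_vec[OF P'(1) P(1) MQx] P'(2) MQx by simp
    hence "Q *\<^sub>v x \<in> mat_kernel M" using Qx by (simp add: mat_kernel[OF Mc])
    then obtain c where c: "Q *\<^sub>v x = c \<cdot>\<^sub>v z" using Mz by blast
    have x': "x = Q' *\<^sub>v (Q *\<^sub>v x)"
      using assoc_mult_mat_vec[OF Q'(1) Q(1) x] Q'(3) x by simp
    have "x $ q = l \<bullet> (Q *\<^sub>v x)"
      by (subst x') (use Q'(1) q in \<open>simp add: l_def\<close>)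
    also have "\<dots> = c * (l \<bullet> z)" unfolding c using l z by simp
    finally have "c = 0" using lz q by (simp add: x_def)
    hence "Q *\<^sub>v x = 0\<^sub>v p" using c z by auto
    hence "x = Q' *\<^sub>v 0\<^sub>v p" using x' by simp
    hence "x = 0\<^sub>v p" using Q'(1) by auto
    have "y $ i = 0" if "i < q" for i
      using arg_cong[OF \<open>x = 0\<^sub>v p\<close>, of "\<lambda>v. v $ i"] that q by (simp add: x_def)
    thus "y \<in> {0\<^sub>v q}" using y(1) by auto
  qed
  hence "vec_space.rank n (drop_last_col N) = q" by (rule rank_eq_if_kernel_trivial[OF D])
  moreover have "drop_last_col ` T \<subseteq> carrier_mat n q"
    using TV P(1) Q(1) V q by (auto simp: drop_last_col_def)
  moreover have "drop_last_col N \<in> drop_last_col ` T" using M TV unfolding N_def by blast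
  ultimately show ?thesis using rank_le_upper_rank[of "drop_last_col ` T" n q] q by fastforce
qed

text \<open>The dual statement. Deleting the last row of \<open>P M Q\<close> composes \<open>M\<close> with a projection along the
  line spanned by \<open>w = P' e\<close>, with \<open>P'\<close> the inverse of \<open>P\<close> and \<open>e\<close> the last unit vector. If \<open>w\<close> is
  not in the range of \<open>M\<close>, the projection is injective on that range and the kernel does not grow.\<close>
lemma upper_rank_drop_last_row_ge:
  fixes V :: "'a::field mat set"
  assumes V: "V \<subseteq> carrier_mat n p" and n: "1 \<le> n"
    and im: "\<And>w. w \<in> carrier_vec n \<Longrightarrow> w \<noteq> 0\<^sub>v n \<Longrightarrow>
      \<exists>M\<in>V. \<exists>z\<in>carrier_vec p. mat_kernel M \<subseteq> range (\<lambda>c. c \<cdot>\<^sub>v z) \<and>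
        w \<notin> (\<lambda>x. M *\<^sub>v x) ` carrier_vec p"
    and T: "mat_equivalent n p V T"
  shows "p - 1 \<le> upper_rank (n - 1) (drop_last_row ` T)"
proof -
  obtain q where q: "n = Suc q" using n by (cases n) auto
  from T obtain P Q where P: "P \<in> carrier_mat n n" "invertible_mat P"
    and Q: "Q \<in> carrier_mat p p" "invertible_mat Q" and TV: "T = (\<lambda>M. P * M * Q) ` V"
    unfolding mat_equivalent_def by blast
  obtain P' where P': "P' \<in> carrier_mat n n" "P * P' = 1\<^sub>m n" "P' * P = 1\<^sub>m n"
    using invertible_matE[OF P(2,1)] by blast
  obtain Q' where Q': "Q' \<in> carrier_mat p p" "Q' * Q = 1\<^sub>m p"
    using invertible_matE[OF Q(2,1)] by blast
  define e :: "'a vec" where "e = unit_vec n q"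
  have e: "e \<in> carrier_vec n" unfolding e_def by simp
  define w where "w = P' *\<^sub>v e"
  have w: "w \<in> carrier_vec n" using P'(1) e unfolding w_def by simp
  have "P *\<^sub>v w = e"
    using assoc_mult_mat_vec[OF P(1) P'(1) e] P'(2) e unfolding w_def by simp
  moreover have "e $ q = 1" using q unfolding e_def by simp
  moreover have "P *\<^sub>v 0\<^sub>v n = 0\<^sub>v n" using P(1) by auto
  ultimately have "w \<noteq> 0\<^sub>v n" using q by (metis index_zero_vec(1) lessI zero_neq_one)
  from im[OF w this] obtain M z where M: "M \<in> V" and z: "z \<in> carrier_vec p"
    and Mz: "mat_kernel M \<subseteq> range (\<lambda>c. c \<cdot>\<^sub>v z)"
    and wM: "w \<notin> (\<lambda>x. M *\<^sub>v x) ` carrier_vec p" by blast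
  have Mc: "M \<in> carrier_mat n p" using M V by blast
  define N where "N = P * M * Q"
  have N: "N \<in> carrier_mat n p" using P Mc Q unfolding N_def by simp
  have D: "drop_last_row N \<in> carrier_mat q p" using N q by (simp add: drop_last_row_def)
  have "mat_kernel (drop_last_row N) \<subseteq> range (\<lambda>c. c \<cdot>\<^sub>v (Q' *\<^sub>v z))"
  proof
    fix x assume "x \<in> mat_kernel (drop_last_row N)"
    hence x: "x \<in> carrier_vec p" "drop_last_row N *\<^sub>v x = 0\<^sub>v q" using mat_kernelD[OF D] by auto
    have Qx: "Q *\<^sub>v x \<in> carrier_vec p" using Q x by simp
    have MQx: "M *\<^sub>v (Q *\<^sub>v x) \<in> carrier_vec n" using Mc Qx by simp
    define c where "c = (N *\<^sub>v x) $ q"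
    have "(N *\<^sub>v x) $ i = (c \<cdot>\<^sub>v e) $ i" if "i < n" for i
      using that drop_last_row_mult_vec[OF N[unfolded q] x(1), of i] x(2) q
      by (cases "i < q") (auto simp: c_def e_def less_Suc_eq)
    hence "N *\<^sub>v x = c \<cdot>\<^sub>v e" using N e by (intro eq_vecI) auto
    moreover have "N *\<^sub>v x = P *\<^sub>v (M *\<^sub>v (Q *\<^sub>v x))"
      unfolding N_def using P(1) Mc Q(1) Qx x
        assoc_mult_mat_vec[of "P * M" n p Q p x] assoc_mult_mat_vec[of P n n M p "Q *\<^sub>v x"] by simp
    ultimately have "P' *\<^sub>v (P *\<^sub>v (M *\<^sub>v (Q *\<^sub>v x))) = c \<cdot>\<^sub>v w"
      using mult_mat_vec[OF P'(1) e] unfolding w_def by simp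
    hence Mcw: "M *\<^sub>v (Q *\<^sub>v x) = c \<cdot>\<^sub>v w"
      using assoc_mult_mat_vec[OF P'(1) P(1) MQx] P'(3) MQx by simp
    have "c = 0"
    proof (rule ccontr)
      assume "c \<noteq> 0"
      hence "w = inverse c \<cdot>\<^sub>v (M *\<^sub>v (Q *\<^sub>v x))"
        unfolding Mcw using w by (auto simp: smult_smult_assoc)
      also have "\<dots> = M *\<^sub>v (inverse c \<cdot>\<^sub>v (Q *\<^sub>v x))" using mult_mat_vec[OF Mc Qx] by simp
      finally have "w \<in> (\<lambda>x. M *\<^sub>v x) ` carrier_vec p" by (rule image_eqI) (use Qx in simp)
      thus False using wM by contradiction
    qed
    hence "Q *\<^sub>v x \<in> mat_kernel M" using Mcw w Qx by (auto simp: mat_kernel[OF Mc])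
    then obtain d where d: "Q *\<^sub>v x = d \<cdot>\<^sub>v z" using Mz by blast
    have "x = Q' *\<^sub>v (Q *\<^sub>v x)"
      using assoc_mult_mat_vec[OF Q'(1) Q(1) x(1)] Q'(2) x(1) by simp
    also have "\<dots> = d \<cdot>\<^sub>v (Q' *\<^sub>v z)" unfolding d using mult_mat_vec[OF Q'(1) z] by simp
    finally show "x \<in> range (\<lambda>c. c \<cdot>\<^sub>v (Q' *\<^sub>v z))" by blast
  qed
  hence "p - 1 \<le> vec_space.rank q (drop_last_row N)" by (rule rank_ge_if_kernel_in_line[OF D])
  moreover have "drop_last_row ` T \<subseteq> carrier_mat q p"
    using TV P(1) Q(1) V q by (auto simp: drop_last_row_def)
  moreover have "drop_last_row N \<in> drop_last_row ` T" using M TV unfolding N_def by blast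
  ultimately show ?thesis using rank_le_upper_rank[of "drop_last_row ` T" q p] q by fastforce
qed

section \<open>Three-by-three matrices\<close>

lemma vec3_eq_iff:
  assumes "v \<in> carrier_vec 3" "w \<in> carrier_vec 3"
  shows "v = w \<longleftrightarrow> v $ 0 = w $ 0 \<and> v $ 1 = w $ 1 \<and> v $ 2 = w $ 2"
  using assms by (auto simp: vec_eq_iff numeral_3_eq_3 less_Suc_eq numeral_2_eq_2)

abbreviation mat3 :: "'a \<Rightarrow> 'a \<Rightarrow> 'a \<Rightarrow> 'a \<Rightarrow> 'a \<Rightarrow> 'a \<Rightarrow> 'a \<Rightarrow> 'a \<Rightarrow> 'a \<Rightarrow> 'a mat" where
  "mat3 a b c d e f g h i \<equiv> mat_of_rows_list 3 [[a, b, c], [d, e, f], [g, h, i]]"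

lemma mat3_carrier: "mat3 a b c d e f g h i \<in> carrier_mat 3 3"
  by (simp add: mat_of_rows_list_def numeral_3_eq_3)

lemma mat3_mult_vec:
  fixes x :: "'a::field vec"
  assumes "x \<in> carrier_vec 3"
  shows "(mat3 a b c d e f g h i *\<^sub>v x) $ 0 = a * x $ 0 + b * x $ 1 + c * x $ 2"
    and "(mat3 a b c d e f g h i *\<^sub>v x) $ 1 = d * x $ 0 + e * x $ 1 + f * x $ 2"
    and "(mat3 a b c d e f g h i *\<^sub>v x) $ 2 = g * x $ 0 + h * x $ 1 + i * x $ 2"
  using assms
  by (simp_all add: mat_of_rows_list_def scalar_prod_def numeral_3_eq_3 numeral_2_eq_2)

lemma mat3_kernel:
  "(k :: 'a::field vec) \<in> mat_kernel (mat3 a b c d e f g h i) \<longleftrightarrow> k \<in> carrier_vec 3 \<and>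
     a * k $ 0 + b * k $ 1 + c * k $ 2 = 0 \<and> d * k $ 0 + e * k $ 1 + f * k $ 2 = 0 \<and>
     g * k $ 0 + h * k $ 1 + i * k $ 2 = 0"
proof -
  have "mat3 a b c d e f g h i *\<^sub>v k \<in> carrier_vec 3" if "k \<in> carrier_vec 3"
    using mult_mat_vec_carrier[OF mat3_carrier that] .
  thus ?thesis
    unfolding mat_kernel[OF mat3_carrier] mem_Collect_eq
    using vec3_eq_iff[of "mat3 a b c d e f g h i *\<^sub>v k" "0\<^sub>v 3"]
      mat3_mult_vec[of k a b c d e f g h i] by auto
qed

lemma mat3_add:
  "mat3 a b c d e f g h i + mat3 a' b' c' d' e' f' g' h' i' =
   mat3 (a + a') (b + b') (c + c') (d + d') (e + e') (f + f') (g + g') (h + h') (i + i')"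
  by (intro eq_matI) (auto simp: mat_of_rows_list_def numeral_3_eq_3 less_Suc_eq)

lemma mat3_smult:
  "k \<cdot>\<^sub>m mat3 a b c d e f g h i =
   mat3 (k * a) (k * b) (k * c) (k * d) (k * e) (k * f) (k * g) (k * h) (k * i)"
  by (intro eq_matI) (auto simp: mat_of_rows_list_def numeral_3_eq_3 less_Suc_eq)

lemma mat3_zero: "0\<^sub>m 3 3 = mat3 0 0 0 0 0 0 0 0 0"
  by (intro eq_matI) (auto simp: mat_of_rows_list_def numeral_3_eq_3 less_Suc_eq)

section \<open>The two spaces and their inclusion\<close>

lemma mat_subspaceI:
  fixes V :: "'a::field mat set"
  assumes "V \<subseteq> carrier_mat n p" "0\<^sub>m n p \<in> V"
    and "\<And>A B. A \<in> V \<Longrightarrow> B \<in> V \<Longrightarrow> A + B \<in> V" "\<And>k A. A \<in> V \<Longrightarrow> k \<cdot>\<^sub>m A \<in> V"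
  shows "mat_subspace n p V"
proof -
  interpret M: vectorspace class_ring "module_mat TYPE('a) n p" by (rule matrix_vs)
  show ?thesis unfolding mat_subspace_def
    by unfold_locales (use assms in \<open>auto simp: module_mat_simps\<close>)
qed

lemma mat_subspace_carrier:
  assumes "mat_subspace n p V"
  shows "V \<subseteq> carrier_mat n p"
  using submodule.subset[OF subspace.submod[OF assms[unfolded mat_subspace_def]]]
  by (simp add: module_mat_simps)

lemma U3_zero: "0\<^sub>m 3 3 \<in> U3"
  unfolding U3_def mat3_zero by (rule CollectI, rule exI[of _ 0], rule exI[of _ 0], rule exI[of _ 0]) simp

lemma U3_subspace: "mat_subspace 3 3 U3"
proof (rule mat_subspaceI)
  show "U3 \<subseteq> carrier_mat 3 3" unfolding U3_def by (auto intro: mat3_carrier simp del: add_bit_eq_xor)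
  show "0\<^sub>m 3 3 \<in> U3"
    unfolding U3_def mat3_zero by (rule CollectI, rule exI[of _ 0], rule exI[of _ 0], rule exI[of _ 0]) simp
next
  fix A B assume "A \<in> U3" "B \<in> U3"
  then obtain a b c a' b' c' where
    "A = mat3 0 a (a + c) a 0 b (a + b) c 0" "B = mat3 0 a' (a' + c') a' 0 b' (a' + b') c' 0"
    unfolding U3_def by blast
  hence "A + B = mat3 0 (a + a') ((a + a') + (c + c')) (a + a') 0 (b + b')
    ((a + a') + (b + b')) (c + c') 0"
    by (simp only: mat3_add ac_simps add_0_left)
  thus "A + B \<in> U3" unfolding U3_def by blast
next
  fix k A assume "A \<in> U3"
  then obtain a b c where "A = mat3 0 a (a + c) a 0 b (a + b) c 0" unfolding U3_def by blast
  hence "k \<cdot>\<^sub>m A = mat3 0 (k * a) (k * a + k * c) (k * a) 0 (k * b) (k * a + k * b) (k * c) 0"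
    by (simp only: mat3_smult distrib_left mult_zero_right)
  thus "k \<cdot>\<^sub>m A \<in> U3" unfolding U3_def by blast
qed

lemma V3_subspace: "mat_subspace 3 3 V3"
proof (rule mat_subspaceI)
  show "V3 \<subseteq> carrier_mat 3 3" unfolding V3_def by (auto intro: mat3_carrier simp del: add_bit_eq_xor)
  show "0\<^sub>m 3 3 \<in> V3"
    unfolding V3_def mat3_zero
    by (rule CollectI, rule exI[of _ 0], rule exI[of _ 0], rule exI[of _ 0], rule exI[of _ 0]) simp
next
  fix A B assume "A \<in> V3" "B \<in> V3"
  then obtain a b c d a' b' c' d' where
    "A = mat3 0 a (c + d) c 0 b (a + b) d 0" "B = mat3 0 a' (c' + d') c' 0 b' (a' + b') d' 0"
    unfolding V3_def by blast
  hence "A + B = mat3 0 (a + a') ((c + c') + (d + d')) (c + c') 0 (b + b')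
    ((a + a') + (b + b')) (d + d') 0"
    by (simp only: mat3_add ac_simps add_0_left)
  thus "A + B \<in> V3" unfolding V3_def by blast
next
  fix k A assume "A \<in> V3"
  then obtain a b c d where "A = mat3 0 a (c + d) c 0 b (a + b) d 0" unfolding V3_def by blast
  hence "k \<cdot>\<^sub>m A = mat3 0 (k * a) (k * c + k * d) (k * c) 0 (k * b) (k * a + k * b) (k * d) 0"
    by (simp only: mat3_smult distrib_left mult_zero_right)
  thus "k \<cdot>\<^sub>m A \<in> V3" unfolding V3_def by blast
qed

lemma U3_subset_V3: "U3 \<subseteq> V3"
proof
  fix M assume "M \<in> U3"
  then obtain a b c where "M = mat3 0 a (a + c) a 0 b (a + b) c 0" unfolding U3_def by blast
  thus "M \<in> V3" unfolding V3_def by blast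
qed

section \<open>Nonzero matrices have rank two\<close>

lemma all_bit_iff: "(\<forall>x::bit. P x) \<longleftrightarrow> P 0 \<and> P 1"
  by (metis bit_not_one_iff)

lemma ex_bit_iff: "(\<exists>x::bit. P x) \<longleftrightarrow> P 0 \<or> P 1"
  by (metis bit_not_one_iff)

text \<open>The off-diagonal entries of a matrix in \<^const>\<open>V3\<close> form two cyclic triples, \<open>(a, b, a + b)\<close> and
  \<open>(c + d, c, d)\<close>, each with sum zero. Three bits with sum zero are never all \<open>1\<close>, and the determinant
  is the sum of the products of the two triples, since the diagonal is zero; so it vanishes. In a
  nonzero triple exactly two entries are \<open>1\<close>, in positions \<open>(i, j)\<close> and \<open>(j, k)\<close>; then rows \<open>i, j\<close>
  and columns \<open>j, k\<close> give a triangular block with \<open>1\<close> on the diagonal, because the entry at \<open>(j, j)\<close>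
  is zero. Hence the kernel has exactly one nonzero vector, which is verified here for each of the
  fifteen parameter values.\<close>
lemma V3_kernel_equations:
  fixes a b c d :: bit
  assumes "\<not> (a = 0 \<and> b = 0 \<and> c = 0 \<and> d = 0)"
  shows "\<exists>z0 z1 z2. \<not> (z0 = 0 \<and> z1 = 0 \<and> z2 = 0) \<and>
    (\<forall>k0 k1 k2. a * k1 + (c + d) * k2 = 0 \<and> c * k0 + b * k2 = 0 \<and> (a + b) * k0 + d * k1 = 0 \<longleftrightarrow>
       (k0 = 0 \<and> k1 = 0 \<and> k2 = 0) \<or> (k0 = z0 \<and> k1 = z1 \<and> k2 = z2))"
  using assms
  by (cases a; cases b; cases c; cases d) (simp_all add: all_bit_iff ex_bit_iff)

lemma rank_nonzero_V3:
  assumes M: "M \<in> V3" "M \<noteq> 0\<^sub>m 3 3"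
  shows "vec_space.rank 3 M = 2"
proof -
  obtain a b c d where Meq: "M = mat3 0 a (c + d) c 0 b (a + b) d 0"
    using M(1) unfolding V3_def by blast
  have "\<not> (a = 0 \<and> b = 0 \<and> c = 0 \<and> d = 0)"
    using M(2) unfolding Meq mat3_zero by auto
  from V3_kernel_equations[OF this] obtain z0 z1 z2 where z: "\<not> (z0 = 0 \<and> z1 = 0 \<and> z2 = 0)"
    and eqs: "\<forall>k0 k1 k2. a * k1 + (c + d) * k2 = 0 \<and> c * k0 + b * k2 = 0 \<and> (a + b) * k0 + d * k1 = 0
      \<longleftrightarrow> (k0 = 0 \<and> k1 = 0 \<and> k2 = 0) \<or> (k0 = z0 \<and> k1 = z1 \<and> k2 = z2)"
    by (elim exE conjE) (rule that)
  define z where "z = vec 3 (\<lambda>i. [z0, z1, z2] ! i)"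
  have zc: "z \<in> carrier_vec 3" unfolding z_def by simp
  have zi: "z $ 0 = z0" "z $ 1 = z1" "z $ 2 = z2" unfolding z_def by simp_all
  have Mc: "M \<in> carrier_mat 3 3" unfolding Meq by (rule mat3_carrier)
  have ker: "k \<in> mat_kernel M \<longleftrightarrow> k = 0\<^sub>v 3 \<or> k = z" for k
  proof (cases "k \<in> carrier_vec 3")
    case True
    thus ?thesis unfolding Meq mat3_kernel vec3_eq_iff[OF True zc]
        vec3_eq_iff[OF True zero_carrier_vec] zi
      using eqs[rule_format, of "k $ 1" "k $ 2" "k $ 0"] by (simp del: add_bit_eq_xor mult_bit_eq_and)
  next
    case False
    thus ?thesis using zc mat_kernelD[OF Mc, of k] by auto
  qed
  have "mat_kernel M \<subseteq> range (\<lambda>c. c \<cdot>\<^sub>v z)"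
  proof
    fix k assume "k \<in> mat_kernel M"
    hence "k = 0 \<cdot>\<^sub>v z \<or> k = 1 \<cdot>\<^sub>v z" using ker zc by auto
    thus "k \<in> range (\<lambda>c. c \<cdot>\<^sub>v z)" by blast
  qed
  from rank_ge_if_kernel_in_line[OF Mc this] have "2 \<le> vec_space.rank 3 M" by simp
  moreover have "z \<noteq> 0\<^sub>v 3" using z zi by auto
  hence "vec_space.rank 3 M < 3" using rank_less_if_kernel_nontrivial[OF Mc] ker by blast
  ultimately show ?thesis by simp
qed

text \<open>Such a \<open>V\<close> has \<open>0\<close> and \<open>2\<close> as its only ranks.\<close>
lemma upper_rank_subset_V3:
  assumes V: "V \<subseteq> V3" "0\<^sub>m 3 3 \<in> V" "A \<in> V" "A \<noteq> 0\<^sub>m 3 3"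
  shows "upper_rank 3 V = 2"
proof -
  have "vec_space.rank 3 M = (if M = 0\<^sub>m 3 3 then 0 else 2)" if "M \<in> V" for M
    using that V(1) rank_nonzero_V3[of M] vec_space.rank_0I[of 3 3] by auto
  hence "vec_space.rank 3 ` V = {0, 2}" using V by (auto simp: image_iff intro: bexI[of _ A])
  thus ?thesis unfolding upper_rank_def by simp
qed

section \<open>Primitivity\<close>

text \<open>These form the basis of \<^const>\<open>U3\<close> given by the parameters \<open>a\<close>, \<open>b\<close>, \<open>c\<close>. They witness all
  the primitivity conditions, because their kernels are spanned by \<open>e\<^sub>1 + e\<^sub>2\<close>, \<open>e\<^sub>1\<close>, \<open>e\<^sub>0\<close> and their
  left kernels by \<open>e\<^sub>1 + e\<^sub>2\<close>, \<open>e\<^sub>0\<close>, \<open>e\<^sub>1\<close> (coordinates are numbered from \<open>0\<close>), each time a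
  basis of the whole space.\<close>
definition U3a :: "bit mat" where "U3a = mat3 0 1 1 1 0 0 1 0 0"
definition U3b :: "bit mat" where "U3b = mat3 0 0 0 0 0 1 1 0 0"
definition U3c :: "bit mat" where "U3c = mat3 0 0 1 0 0 0 0 1 0"

lemma U3abc_in_U3: "U3a \<in> U3" "U3b \<in> U3" "U3c \<in> U3"
proof -
  have "U3a = mat3 0 1 (1 + 0) 1 0 0 (1 + 0) 0 0" unfolding U3a_def by simp
  thus "U3a \<in> U3" unfolding U3_def by blast
  have "U3b = mat3 0 0 (0 + 0) 0 0 1 (0 + 1) 0 0" unfolding U3b_def by simp
  thus "U3b \<in> U3" unfolding U3_def by blast
  have "U3c = mat3 0 0 (0 + 1) 0 0 0 (0 + 0) 1 0" unfolding U3c_def by simp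
  thus "U3c \<in> U3" unfolding U3_def by blast
qed

lemma bit_add_eq_0_iff: "x + y = 0 \<longleftrightarrow> x = y" for x y :: bit
  by (cases x; cases y) simp_all

lemma U3abc_kernel:
  "k \<in> mat_kernel U3a \<longleftrightarrow> k \<in> carrier_vec 3 \<and> k $ 0 = 0 \<and> k $ 1 = k $ 2"
  "k \<in> mat_kernel U3b \<longleftrightarrow> k \<in> carrier_vec 3 \<and> k $ 0 = 0 \<and> k $ 2 = 0"
  "k \<in> mat_kernel U3c \<longleftrightarrow> k \<in> carrier_vec 3 \<and> k $ 1 = 0 \<and> k $ 2 = 0"
  unfolding U3a_def U3b_def U3c_def mat3_kernel
  by (auto simp: bit_add_eq_0_iff simp del: add_bit_eq_xor mult_bit_eq_and bit_not_zero_iff)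

lemma U3abc_kernel_in_line:
  "mat_kernel U3a \<subseteq> range (\<lambda>c. c \<cdot>\<^sub>v (unit_vec 3 1 + unit_vec 3 2))"
  "mat_kernel U3b \<subseteq> range (\<lambda>c. c \<cdot>\<^sub>v unit_vec 3 1)"
  "mat_kernel U3c \<subseteq> range (\<lambda>c. c \<cdot>\<^sub>v unit_vec 3 0)"
proof -
  have "k = (k $ 1) \<cdot>\<^sub>v (unit_vec 3 1 + unit_vec 3 2)" if "k \<in> mat_kernel U3a" for k
    using that unfolding U3abc_kernel by (subst vec3_eq_iff) (auto simp del: mult_bit_eq_and)
  thus "mat_kernel U3a \<subseteq> range (\<lambda>c. c \<cdot>\<^sub>v (unit_vec 3 1 + unit_vec 3 2))" by blast
  have "k = (k $ 1) \<cdot>\<^sub>v unit_vec 3 1" if "k \<in> mat_kernel U3b" for k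
    using that unfolding U3abc_kernel by (subst vec3_eq_iff) (auto simp del: mult_bit_eq_and)
  thus "mat_kernel U3b \<subseteq> range (\<lambda>c. c \<cdot>\<^sub>v unit_vec 3 1)" by blast
  have "k = (k $ 0) \<cdot>\<^sub>v unit_vec 3 0" if "k \<in> mat_kernel U3c" for k
    using that unfolding U3abc_kernel by (subst vec3_eq_iff) (auto simp del: mult_bit_eq_and)
  thus "mat_kernel U3c \<subseteq> range (\<lambda>c. c \<cdot>\<^sub>v unit_vec 3 0)" by blast
qed

lemma U3abc_range:
  assumes "x \<in> carrier_vec 3"
  shows "(U3a *\<^sub>v x) $ 1 = (U3a *\<^sub>v x) $ 2" "(U3b *\<^sub>v x) $ 0 = 0" "(U3c *\<^sub>v x) $ 1 = 0"
  unfolding U3a_def U3b_def U3c_def mat3_mult_vec[OF assms] by simp_all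

text \<open>A functional that vanishes at \<open>e\<^sub>0\<close>, \<open>e\<^sub>1\<close> and \<open>e\<^sub>1 + e\<^sub>2\<close> is zero.\<close>
lemma U3_kernels_span:
  fixes l :: "bit vec"
  assumes "l \<in> carrier_vec 3" "l \<noteq> 0\<^sub>v 3"
  shows "\<exists>M\<in>U3. \<exists>z\<in>carrier_vec 3. mat_kernel M \<subseteq> range (\<lambda>c. c \<cdot>\<^sub>v z) \<and> l \<bullet> z \<noteq> 0"
proof -
  consider "l $ 0 \<noteq> 0" | "l $ 1 \<noteq> 0" | "l $ 1 = 0" "l $ 2 \<noteq> 0"
    using assms vec3_eq_iff[OF assms(1) zero_carrier_vec]
    by (auto simp del: bit_not_zero_iff bit_not_one_iff)
  thus ?thesis
  proof cases
    case 1
    hence "l \<bullet> unit_vec 3 0 \<noteq> 0" using assms(1) by simp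
    thus ?thesis using U3abc_kernel_in_line(3)
      by (intro bexI[OF _ U3abc_in_U3(3)] bexI[of _ "unit_vec 3 0"] conjI) simp_all
  next
    case 2
    hence "l \<bullet> unit_vec 3 1 \<noteq> 0" using assms(1) by simp
    thus ?thesis using U3abc_kernel_in_line(2)
      by (intro bexI[OF _ U3abc_in_U3(2)] bexI[of _ "unit_vec 3 1"] conjI) simp_all
  next
    case 3
    hence "l \<bullet> (unit_vec 3 1 + unit_vec 3 2) \<noteq> 0"
      using assms(1) by (simp add: scalar_prod_add_distrib[of _ 3])
    thus ?thesis using U3abc_kernel_in_line(1)
      by (intro bexI[OF _ U3abc_in_U3(1)] bexI[of _ "unit_vec 3 1 + unit_vec 3 2"] conjI) simp_all
  qed
qed

text \<open>The ranges are the planes \<open>w\<^sub>0 = 0\<close>, \<open>w\<^sub>1 = 0\<close> and \<open>w\<^sub>1 = w\<^sub>2\<close>, which meet only in zero.\<close>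
lemma U3_ranges_meet_trivially:
  fixes w :: "bit vec"
  assumes "w \<in> carrier_vec 3" "w \<noteq> 0\<^sub>v 3"
  shows "\<exists>M\<in>U3. \<exists>z\<in>carrier_vec 3. mat_kernel M \<subseteq> range (\<lambda>c. c \<cdot>\<^sub>v z) \<and>
    w \<notin> (\<lambda>x. M *\<^sub>v x) ` carrier_vec 3"
proof -
  consider "w $ 0 \<noteq> 0" | "w $ 1 \<noteq> 0" | "w $ 1 = 0" "w $ 2 \<noteq> 0"
    using assms vec3_eq_iff[OF assms(1) zero_carrier_vec]
    by (auto simp del: bit_not_zero_iff bit_not_one_iff)
  thus ?thesis
  proof cases
    case 1
    hence "w \<notin> (\<lambda>x. U3b *\<^sub>v x) ` carrier_vec 3" using U3abc_range(2) by auto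
    thus ?thesis using U3abc_kernel_in_line(2)
      by (intro bexI[OF _ U3abc_in_U3(2)] bexI[of _ "unit_vec 3 1"] conjI) simp_all
  next
    case 2
    hence "w \<notin> (\<lambda>x. U3c *\<^sub>v x) ` carrier_vec 3" using U3abc_range(3) by auto
    thus ?thesis using U3abc_kernel_in_line(3)
      by (intro bexI[OF _ U3abc_in_U3(3)] bexI[of _ "unit_vec 3 0"] conjI) simp_all
  next
    case 3
    hence "w $ 1 \<noteq> w $ 2" by simp
    hence "w \<notin> (\<lambda>x. U3a *\<^sub>v x) ` carrier_vec 3" using U3abc_range(1) by auto
    thus ?thesis using U3abc_kernel_in_line(1)
      by (intro bexI[OF _ U3abc_in_U3(1)] bexI[of _ "unit_vec 3 1 + unit_vec 3 2"] conjI) simp_all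
  qed
qed

lemma U3_ranges_span:
  assumes V: "U3 \<subseteq> V" "V \<subseteq> carrier_mat 3 3"
  shows "LinearCombinations.module.span class_ring (module_vec TYPE(bit) 3)
    (\<Union>M \<in> V. (\<lambda>x. M *\<^sub>v x) ` carrier_vec 3) = carrier_vec 3"
proof -
  interpret W: vec_space "TYPE(bit)" 3 .
  define S :: "bit vec set" where "S = (\<Union>M \<in> V. (\<lambda>x. M *\<^sub>v x) ` carrier_vec 3)"
  have S: "S \<subseteq> carrier_vec 3" using V(2) unfolding S_def by auto
  have "unit_vec 3 0 = U3c *\<^sub>v unit_vec 3 2" "unit_vec 3 1 = U3b *\<^sub>v unit_vec 3 2"
    "unit_vec 3 2 = U3b *\<^sub>v unit_vec 3 0"
    by (intro eq_vecI; auto simp: U3c_def U3b_def mat_of_rows_list_def scalar_prod_def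
        numeral_3_eq_3 numeral_2_eq_2 less_Suc_eq)+
  hence "{unit_vec 3 0, unit_vec 3 1, unit_vec 3 2} \<subseteq> S"
    using V(1) U3abc_in_U3 unit_vec_carrier unfolding S_def by blast
  hence "set (unit_vecs 3) \<subseteq> S" by (simp add: unit_vecs_def upt_rec numeral_2_eq_2)
  hence "W.span (set (unit_vecs 3)) \<subseteq> W.span S" by (rule W.span_is_monotone)
  moreover have "W.span S \<subseteq> carrier_vec 3" by (rule W.span_is_subset2[OF S])
  ultimately show ?thesis unfolding W.span_unit_vecs_is_carrier S_def[symmetric] by blast
qed

text \<open>Each primitivity condition asks for suitable members of the space once the upper rank is
  known, so those of \<^const>\<open>U3\<close> serve every larger space of the same upper rank, \<^const>\<open>V3\<close> among them.\<close>
lemma primitive_if_contains_U3: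
  assumes sub: "mat_subspace 3 3 V" and U3: "U3 \<subseteq> V" and urk: "upper_rank 3 V = 2"
  shows "primitive_space 3 3 V"
  unfolding primitive_space_def
proof (intro conjI)
  note V = U3 mat_subspace_carrier[OF sub]
  show "\<not> (\<exists>x\<in>carrier_vec 3. x \<noteq> 0\<^sub>v 3 \<and> (\<forall>M\<in>V. x \<in> mat_kernel M))"
  proof
    assume "\<exists>x\<in>carrier_vec 3. x \<noteq> 0\<^sub>v 3 \<and> (\<forall>M\<in>V. x \<in> mat_kernel M)"
    then obtain x where x: "x \<in> carrier_vec 3" "x \<noteq> 0\<^sub>v 3" "\<And>M. M \<in> V \<Longrightarrow> x \<in> mat_kernel M"
      by blast
    have "x \<in> mat_kernel U3b" "x \<in> mat_kernel U3c" using x(3) V(1) U3abc_in_U3 by auto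
    hence "x = 0\<^sub>v 3" unfolding U3abc_kernel by (subst vec3_eq_iff) auto
    thus False using x(2) by simp
  qed
  show "\<not> (1 \<le> (3::nat) \<and> (\<exists>T. mat_equivalent 3 3 V T \<and>
      upper_rank 3 (drop_last_col ` T) < upper_rank 3 V))"
  proof -
    have "2 \<le> upper_rank 3 (drop_last_col ` T)" if "mat_equivalent 3 3 V T" for T
      using upper_rank_drop_last_col_ge[OF V(2) _ that] U3_kernels_span V(1) by fastforce
    thus ?thesis using urk by force
  qed
  show "\<not> (1 \<le> (3::nat) \<and> (\<exists>T. mat_equivalent 3 3 V T \<and>
      upper_rank (3 - 1) (drop_last_row ` T) < upper_rank 3 V))"
  proof -
    have "2 \<le> upper_rank (3 - 1) (drop_last_row ` T)" if "mat_equivalent 3 3 V T" for T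
    proof -
      have "3 - 1 \<le> upper_rank (3 - 1) (drop_last_row ` T)"
      proof (rule upper_rank_drop_last_row_ge[OF V(2) _ _ that])
        fix w :: "bit vec" assume "w \<in> carrier_vec 3" "w \<noteq> 0\<^sub>v 3"
        from U3_ranges_meet_trivially[OF this] V(1)
        show "\<exists>M\<in>V. \<exists>z\<in>carrier_vec 3. mat_kernel M \<subseteq> range (\<lambda>c. c \<cdot>\<^sub>v z) \<and>
          w \<notin> (\<lambda>x. M *\<^sub>v x) ` carrier_vec 3" by (meson subsetD)
      qed simp
      thus ?thesis by simp
    qed
    thus ?thesis using urk by force
  qed
qed (rule sub, rule U3_ranges_span[OF U3 mat_subspace_carrier[OF sub]])

theorem proposition1p3:
  shows "primitive_space 3 3 U3 \<and> upper_rank 3 U3 = 2 \<and>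
         primitive_space 3 3 V3 \<and> upper_rank 3 V3 = 2 \<and>
         (\<forall>M \<in> U3. M \<noteq> 0\<^sub>m 3 3 \<longrightarrow> vec_space.rank 3 M = 2) \<and>
         (\<forall>M \<in> V3. M \<noteq> 0\<^sub>m 3 3 \<longrightarrow> vec_space.rank 3 M = 2)"
proof -
  have zero: "0\<^sub>m 3 3 \<in> U3" by (rule U3_zero)
  have "U3b $$ (1, 2) \<noteq> 0\<^sub>m 3 3 $$ (1, 2)"
    by (simp add: U3b_def mat_of_rows_list_def numeral_3_eq_3 numeral_2_eq_2)
  hence U3b: "U3b \<noteq> 0\<^sub>m 3 3" by metis
  have urk: "upper_rank 3 U3 = 2" "upper_rank 3 V3 = 2"
    using upper_rank_subset_V3[OF _ _ _ U3b] zero U3abc_in_U3(2) U3_subset_V3 by blast+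
  have "primitive_space 3 3 U3"
    by (rule primitive_if_contains_U3[OF U3_subspace subset_refl urk(1)])
  moreover have "primitive_space 3 3 V3"
    by (rule primitive_if_contains_U3[OF V3_subspace U3_subset_V3 urk(2)])
  moreover have "\<forall>M \<in> V3. M \<noteq> 0\<^sub>m 3 3 \<longrightarrow> vec_space.rank 3 M = 2"
    using rank_nonzero_V3 by auto
  ultimately show ?thesis using urk U3_subset_V3 by auto
qed

end
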